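(* Let $k\ge0$, $n\geq1$, and let $A$ be an algebra over $\mathrm{BSu}^k(\mathit{Com})$, with generating operations $\star_{(i_1,\dots,i_k)}$, $(i_1,\dots,i_k)\in\{0,1\}^k$. Then the space $\mathcal{M}_n(A)$ of $n\times n$ matrices with coefficients in $A$ carries a structure, functorial in $A$, of algebra over the nonsymmetric operad $\mathit{Dend}^{\blacksquare k}$. More precisely, this structure is given by the generating operations $$\ast_{(i_1,\dots,i_k)}:\mathcal{M}_n(A)\otimes\mathcal{M}_n(A)\to\mathcal{M}_n(A),\qquad (M\ast_{(i_1,\dots,i_k)}N)_{i,j}:=\sum_{l=1}^nM_{i,l}\star_{(i_1,\dots,i_k)}N_{l,j},$$ for $(i_1,\dots,i_k)\in\{0,1\}^k$. In particular, these operations satisfy $${}^t(M\ast_{(i_1,\dots,i_k)}N)={}^tN\ast_{(1-i_1,\dots,1-i_k)}{}^tM\qquad\forall (i_1,\dots,i_k)\in\{0,1\}^k,\ \forall M,N\in\mathcal{M}_n(A),$$ where ${}^tM$ is the transpose.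
   Context: Fix a field $\mathbf{k}$. $\mathit{Com}$ is the symmetric operad of commutative associative (non-unital) algebras, with generating operation $\star$; $\mathit{As}$ is the nonsymmetric (ns) operad of associative algebras. **Free operads.** For a vector space $V$ in arity 2, $\mathcal{T}_{ns}(V)$ is the free ns operad: in arity $m$, planar binary trees with $m$ leaves (numbered from left to right) and vertices labeled multilinearly by $V$. For an $\mathbb S_2$-module $V$, $\mathcal{T}(V)$ is the free symmetric operad: the same trees with leaves labeled bijectively by $\{1,\dots,m\}$, modulo: exchanging the two subtrees of a vertex labeled $\omega$ gives the same element after replacing $\omega$ by $\omega^{(12)}$. **Bisuccessor.** For a binary operad $\mathcal P=\mathcal T(V)/(R)$ with $R$ generated by homogeneous elements: $\widetilde V=V\otimes(\mathbf{k}\prec\oplus\,\mathbf{k}\succ)$, $\omega_\prec=\omega\otimes\prec$, $\omega_\succ=\omega\otimes\succ$, $\omega_{\prec+\succ}=\omega_\prec+\omega_\succ$, with $(\omega_\prec)^{(12)}=(\omega^{(12)})_\succ$, $(\omega_\succ)^{(12)}=(\omega^{(12)})_\prec$. For a labeled tree $\tau$ and leaf $x$, $\mathrm{BSu}_x(\tau)$ is obtained by relabeling: a vertex labeled $\omega$ on the path from the root to $x$ gets $\omega_\prec$ (resp. $\omega_\succ$) if the path turns left (resp. right) there; every other vertex labeled $\omega$ gets $\omega_{\prec+\succ}$. $\mathrm{BSu}(\mathcal P)=\mathcal T(\widetilde V)/(\mathrm{BSu}_x(r):r\in R,\ x \text{ a leaf})$, and $\mathrm{BSu}^k$ is the $k$-fold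 iterate, $\mathrm{BSu}^0(\mathcal P)=\mathcal P$. The generators of $\mathrm{BSu}^k(\mathit{Com})$ are spanned by $\star_{(i_1,\dots,i_k)}=\star\otimes\mu_1\otimes\cdots\otimes\mu_k$, where $\mu_l\in\{\prec,\succ\}$, $i_l=0$ if $\mu_l=\prec$ and $i_l=1$ if $\mu_l=\succ$. **Dend and the black square product.** $\mathit{Dend}$ is the ns operad of dendriform algebras: operations $\prec,\succ$ with $(x\prec y)\prec z=x\prec(y\prec z+y\succ z)$, $(x\succ y)\prec z=x\succ(y\prec z)$, $(x\prec y+x\succ y)\succ z=x\succ(y\succ z)$. For binary quadratic ns operads $\mathcal{T}_{ns}(V)/(R)$ and $\mathcal{T}_{ns}(W)/(S)$, with $R\subseteq (V\circ_1V)\oplus(V\circ_2V)$ (where $\omega\circ_1\nu=\omega(\nu(x,y),z)$, $\omega\circ_2\nu=\omega(x,\nu(y,z))$) and similarly $S$, the black square product is $\mathcal{T}_{ns}(V\otimes W)/(\Psi(R\otimes S))$ with $\Psi((\omega\circ_1\nu)\otimes(\omega'\circ_1\nu'))=(\omega\otimes\omega')\circ_1(\nu\otimes\nu')$, $\Psi((\omega\circ_2\nu)\otimes(\omega'\circ_2\nu'))=-(\omega\otimes\omega')\circ_2(\nu\otimes\nu')$, and $\Psi=0$ on mixed terms. $\mathit{Dend}^{\blacksquare k}$ is the $k$-fold black square power ($\mathit{Dend}^{\blacksquare0}=\mathit{As}$); its generators are spanned by $\ast_{(i_1,\dots,i_k)}=\mu_1\otimes\cdots\otimes\mu_k$, with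 $\mu_l=\prec$ if $i_l=0$ and $\mu_l=\succ$ if $i_l=1$. *)

theory Defs
  imports
    "HOL-Analysis.Finite_Cartesian_Product"
    "HOL-Library.Poly_Mapping"
    "HOL-Combinatorics.Permutations"
begin

section \<open>Formal linear combinations\<close>

definition fscale :: "'k::field \<Rightarrow> ('t \<Rightarrow>\<^sub>0 'k) \<Rightarrow> ('t \<Rightarrow>\<^sub>0 'k)" where
  "fscale c p = Poly_Mapping.map ((*) c) p"

abbreviation basis :: "'t \<Rightarrow> ('t \<Rightarrow>\<^sub>0 'k::field)" where
  "basis t \<equiv> Poly_Mapping.single t 1"

text \<open>The linear extension of \<open>f\<close>, with values in a space whose scalar multiplication is \<open>s\<close>.\<close>

definition lin_ext ::
  "('k::field \<Rightarrow> 'b \<Rightarrow> 'b) \<Rightarrow> ('t \<Rightarrow> 'b) \<Rightarrow> ('t \<Rightarrow>\<^sub>0 'k) \<Rightarrow> 'b::comm_monoid_add" where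
  "lin_ext s f p = (\<Sum>t\<in>Poly_Mapping.keys p. s (Poly_Mapping.lookup p t) (f t))"

section \<open>Labelled planar binary trees\<close>

text \<open>
  A space \<open>V\<close> of binary generators is given through a basis, a set \<open>X\<close> of labels. By
  multilinearity in the vertices, the planar trees with vertices labelled in \<open>X\<close> form a basis of
  the free ns operad on \<open>V\<close> (leaves numbered from left to right) and span the free symmetric operad
  on \<open>V\<close> (leaves labelled bijectively); in the symmetric case the exchange of subtrees is imposed
  in \<open>sym_ideal\<close> below.
\<close>

datatype (labels: 'g) tree = Leaf nat | Node 'g "'g tree" "'g tree"

primrec leaves :: "'g tree \<Rightarrow> nat list" where
  "leaves (Leaf i) = [i]"
| "leaves (Node g l r) = leaves l @ leaves r"

definition sym_trees :: "'g set \<Rightarrow> nat \<Rightarrow> 'g tree set" where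
  "sym_trees X m = {t. labels t \<subseteq> X \<and> distinct (leaves t) \<and> set (leaves t) = {1..m}}"

definition ns_trees :: "'g set \<Rightarrow> nat \<Rightarrow> 'g tree set" where
  "ns_trees X m = {t. labels t \<subseteq> X \<and> leaves t = [1..<Suc m]}"

primrec tree_subst :: "(nat \<Rightarrow> 'g tree) \<Rightarrow> 'g tree \<Rightarrow> 'g tree" where
  "tree_subst f (Leaf i) = f i"
| "tree_subst f (Node g l r) = Node g (tree_subst f l) (tree_subst f r)"

definition relabel_leaves :: "(nat \<Rightarrow> nat) \<Rightarrow> 'g tree \<Rightarrow> 'g tree" where
  "relabel_leaves \<sigma> = tree_subst (\<lambda>j. Leaf (\<sigma> j))"

text \<open>The partial composition \<open>t \<circ>\<^sub>i u\<close>, with the usual renumbering of the leaves.\<close>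

definition tree_comp :: "'g tree \<Rightarrow> nat \<Rightarrow> 'g tree \<Rightarrow> 'g tree" where
  "tree_comp t i u = tree_subst (\<lambda>j.
     if j < i then Leaf j
     else if j = i then relabel_leaves (\<lambda>a. a + i - 1) u
     else Leaf (j + length (leaves u) - 1)) t"

definition partial_comp ::
  "('g tree \<Rightarrow>\<^sub>0 'k::field) \<Rightarrow> nat \<Rightarrow> ('g tree \<Rightarrow>\<^sub>0 'k) \<Rightarrow> ('g tree \<Rightarrow>\<^sub>0 'k)" where
  "partial_comp p i q =
     lin_ext fscale (\<lambda>t. lin_ext fscale (\<lambda>u. basis (tree_comp t i u)) q) p"

definition node_lin ::
  "'g \<Rightarrow> ('g tree \<Rightarrow>\<^sub>0 'k::field) \<Rightarrow> ('g tree \<Rightarrow>\<^sub>0 'k) \<Rightarrow> ('g tree \<Rightarrow>\<^sub>0 'k)" where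
  "node_lin g p q = lin_ext fscale (\<lambda>l. lin_ext fscale (\<lambda>r. basis (Node g l r)) q) p"

section \<open>Binary operads given by generators and relations\<close>

record (overloaded) ('g, 'k) presentation =
  gens :: "'g set"
  rels :: "('g tree \<Rightarrow>\<^sub>0 'k::zero) set"

text \<open>\<open>act P g\<close> is the image of the basis vector \<open>g\<close> under the transposition \<open>(12)\<close>.\<close>

record (overloaded) ('g, 'k) sym_presentation = "('g, 'k::zero) presentation" +
  act :: "'g \<Rightarrow> ('g \<Rightarrow>\<^sub>0 'k)"

text \<open>
  \<open>sym_ideal P m\<close> is the subspace of the span of \<open>sym_trees (gens P) m\<close> whose quotient is the
  arity \<open>m\<close> component of the operad presented by \<open>P\<close>: it is generated, under the operations of
  a symmetric operad, by the relators and by the exchanges of the two subtrees of a vertex.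
\<close>

inductive sym_ideal ::
  "('g, 'k::field) sym_presentation \<Rightarrow> nat \<Rightarrow> ('g tree \<Rightarrow>\<^sub>0 'k) \<Rightarrow> bool"
  for P :: "('g, 'k::field) sym_presentation" where
  rel: "\<lbrakk>p \<in> rels P; Poly_Mapping.keys p \<subseteq> sym_trees (gens P) m\<rbrakk> \<Longrightarrow> sym_ideal P m p"
| exchange: "Node g l r \<in> sym_trees (gens P) m \<Longrightarrow>
    sym_ideal P m (basis (Node g l r) - lin_ext fscale (\<lambda>h. basis (Node h r l)) (act P g))"
| zero: "sym_ideal P m 0"
| add: "\<lbrakk>sym_ideal P m p; sym_ideal P m q\<rbrakk> \<Longrightarrow> sym_ideal P m (p + q)"
| scale: "sym_ideal P m p \<Longrightarrow> sym_ideal P m (fscale c p)"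
| perm: "\<lbrakk>sym_ideal P m p; \<sigma> permutes {1..m}\<rbrakk> \<Longrightarrow>
    sym_ideal P m (lin_ext fscale (\<lambda>t. basis (relabel_leaves \<sigma> t)) p)"
| comp_left: "\<lbrakk>sym_ideal P m p; i \<in> {1..m}; u \<in> sym_trees (gens P) n\<rbrakk> \<Longrightarrow>
    sym_ideal P (m + n - 1) (partial_comp p i (basis u))"
| comp_right: "\<lbrakk>sym_ideal P n p; t \<in> sym_trees (gens P) m; i \<in> {1..m}\<rbrakk> \<Longrightarrow>
    sym_ideal P (m + n - 1) (partial_comp (basis t) i p)"

inductive ns_ideal ::
  "('g, 'k::field) presentation \<Rightarrow> nat \<Rightarrow> ('g tree \<Rightarrow>\<^sub>0 'k) \<Rightarrow> bool"
  for P :: "('g, 'k::field) presentation" where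
  rel: "\<lbrakk>p \<in> rels P; Poly_Mapping.keys p \<subseteq> ns_trees (gens P) m\<rbrakk> \<Longrightarrow> ns_ideal P m p"
| zero: "ns_ideal P m 0"
| add: "\<lbrakk>ns_ideal P m p; ns_ideal P m q\<rbrakk> \<Longrightarrow> ns_ideal P m (p + q)"
| scale: "ns_ideal P m p \<Longrightarrow> ns_ideal P m (fscale c p)"
| comp_left: "\<lbrakk>ns_ideal P m p; i \<in> {1..m}; u \<in> ns_trees (gens P) n\<rbrakk> \<Longrightarrow>
    ns_ideal P (m + n - 1) (partial_comp p i (basis u))"
| comp_right: "\<lbrakk>ns_ideal P n p; t \<in> ns_trees (gens P) m; i \<in> {1..m}\<rbrakk> \<Longrightarrow>
    ns_ideal P (m + n - 1) (partial_comp (basis t) i p)"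

section \<open>Algebras\<close>

text \<open>
  By freeness, a morphism from the presented operad to the endomorphism operad of a vector space is
  the same as a family of bilinear operations indexed by the basis of the generators, such that the
  induced map on trees kills the ideal. In the symmetric case, equivariance of the operations is the
  vanishing on the exchange elements of the ideal.
\<close>

primrec eval_tree :: "('g \<Rightarrow> 'a \<Rightarrow> 'a \<Rightarrow> 'a) \<Rightarrow> (nat \<Rightarrow> 'a) \<Rightarrow> 'g tree \<Rightarrow> 'a" where
  "eval_tree opr v (Leaf i) = v i"
| "eval_tree opr v (Node g l r) = opr g (eval_tree opr v l) (eval_tree opr v r)"

definition bilinear_ops ::
  "('k::field \<Rightarrow> 'a::ab_group_add \<Rightarrow> 'a) \<Rightarrow> ('g \<Rightarrow> 'a \<Rightarrow> 'a \<Rightarrow> 'a) \<Rightarrow> 'g set \<Rightarrow> bool" where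
  "bilinear_ops s opr X \<longleftrightarrow> vector_space s \<and>
     (\<forall>g\<in>X. \<forall>a. Vector_Spaces.linear s s (\<lambda>b. opr g a b) \<and>
                Vector_Spaces.linear s s (\<lambda>b. opr g b a))"

definition sym_algebra ::
  "('g, 'k::field) sym_presentation \<Rightarrow> ('k \<Rightarrow> 'a::ab_group_add \<Rightarrow> 'a) \<Rightarrow>
   ('g \<Rightarrow> 'a \<Rightarrow> 'a \<Rightarrow> 'a) \<Rightarrow> bool" where
  "sym_algebra P s opr \<longleftrightarrow> bilinear_ops s opr (gens P) \<and>
     (\<forall>m p v. sym_ideal P m p \<longrightarrow> lin_ext s (eval_tree opr v) p = 0)"

definition ns_algebra ::
  "('g, 'k::field) presentation \<Rightarrow> ('k \<Rightarrow> 'a::ab_group_add \<Rightarrow> 'a) \<Rightarrow>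
   ('g \<Rightarrow> 'a \<Rightarrow> 'a \<Rightarrow> 'a) \<Rightarrow> bool" where
  "ns_algebra P s opr \<longleftrightarrow> bilinear_ops s opr (gens P) \<and>
     (\<forall>m p v. ns_ideal P m p \<longrightarrow> lin_ext s (eval_tree opr v) p = 0)"

text \<open>
  As \<open>X\<close> generates the operad, commuting with the generating operations is commuting with all
  operations.
\<close>

definition algebra_hom ::
  "'g set \<Rightarrow> ('k::field \<Rightarrow> 'a::ab_group_add \<Rightarrow> 'a) \<Rightarrow> ('g \<Rightarrow> 'a \<Rightarrow> 'a \<Rightarrow> 'a) \<Rightarrow>
   ('k \<Rightarrow> 'b::ab_group_add \<Rightarrow> 'b) \<Rightarrow> ('g \<Rightarrow> 'b \<Rightarrow> 'b \<Rightarrow> 'b) \<Rightarrow> ('a \<Rightarrow> 'b) \<Rightarrow> bool" where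
  "algebra_hom X s opr s' opr' f \<longleftrightarrow> Vector_Spaces.linear s s' f \<and>
     (\<forall>g\<in>X. \<forall>a b. f (opr g a b) = opr' g (f a) (f b))"

section \<open>The bisuccessor\<close>

datatype dir = Prec | Succ

primrec flip :: "dir \<Rightarrow> dir" where
  "flip Prec = Succ"
| "flip Succ = Prec"

text \<open>
  A label \<open>w @ [\<mu>]\<close> stands for \<open>\<omega> \<otimes> \<mu>\<close>, where \<open>w\<close> is the label of the basis vector \<open>\<omega>\<close>; thus
  bases are sets of lists, so that the construction can be iterated. \<open>bsu_off\<close> gives the label
  \<open>\<omega>\<^sub>\<prec> + \<omega>\<^sub>\<succ>\<close> to all vertices of a tree, expanded multilinearly.
\<close>

primrec bsu_off :: "dir list tree \<Rightarrow> (dir list tree \<Rightarrow>\<^sub>0 'k::field)" where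
  "bsu_off (Leaf i) = basis (Leaf i)"
| "bsu_off (Node w l r) =
     node_lin (w @ [Prec]) (bsu_off l) (bsu_off r) + node_lin (w @ [Succ]) (bsu_off l) (bsu_off r)"

primrec bsu_tree :: "nat \<Rightarrow> dir list tree \<Rightarrow> (dir list tree \<Rightarrow>\<^sub>0 'k::field)" where
  "bsu_tree x (Leaf i) = basis (Leaf i)"
| "bsu_tree x (Node w l r) =
     (if x \<in> set (leaves l) then node_lin (w @ [Prec]) (bsu_tree x l) (bsu_off r)
      else node_lin (w @ [Succ]) (bsu_off l) (bsu_tree x r))"

definition BSu ::
  "(dir list, 'k::field) sym_presentation \<Rightarrow> (dir list, 'k) sym_presentation" where
  "BSu P = \<lparr>
     gens = {w @ [\<mu>] | w \<mu>. w \<in> gens P},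
     rels = {lin_ext fscale (bsu_tree x) p | p x.
               p \<in> rels P \<and> x \<in> (\<Union>t\<in>Poly_Mapping.keys p. set (leaves t))},
     act = (\<lambda>u. lin_ext fscale (\<lambda>w. basis (w @ [flip (last u)])) (act P (butlast u)))\<rparr>"

text \<open>The trees \<open>\<omega> \<circ>\<^sub>1 \<nu>\<close> and \<open>\<omega> \<circ>\<^sub>2 \<nu>\<close>.\<close>

definition comp1 :: "'g \<Rightarrow> 'g \<Rightarrow> 'g tree" where
  "comp1 g h = Node g (Node h (Leaf 1) (Leaf 2)) (Leaf 3)"

definition comp2 :: "'g \<Rightarrow> 'g \<Rightarrow> 'g tree" where
  "comp2 g h = Node g (Leaf 1) (Node h (Leaf 2) (Leaf 3))"

text \<open>The generator \<open>\<star>\<close> is labelled by the empty list.\<close>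

definition Com :: "(dir list, 'k::field) sym_presentation" where
  "Com = \<lparr>gens = {[]}, rels = {basis (comp1 [] []) - basis (comp2 [] [])}, act = basis\<rparr>"

section \<open>The black square product\<close>

fun psi_tree ::
  "('g \<Rightarrow> 'h \<Rightarrow> 'i) \<Rightarrow> 'g tree \<Rightarrow> 'h tree \<Rightarrow> ('i tree \<Rightarrow>\<^sub>0 'k::field)" where
  "psi_tree tens (Node g (Node h (Leaf _) (Leaf _)) (Leaf _))
                 (Node g' (Node h' (Leaf _) (Leaf _)) (Leaf _)) =
     basis (comp1 (tens g g') (tens h h'))"
| "psi_tree tens (Node g (Leaf _) (Node h (Leaf _) (Leaf _)))
                 (Node g' (Leaf _) (Node h' (Leaf _) (Leaf _))) =
     - basis (comp2 (tens g g') (tens h h'))"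
| "psi_tree tens _ _ = 0"

text \<open>
  \<open>tens g h\<close> is the label of the basis vector \<open>g \<otimes> h\<close>; it has to be injective on
  \<open>gens P \<times> gens Q\<close>. As \<open>\<Psi>\<close> is bilinear, it suffices to apply it to spanning sets of relators.
\<close>

definition black_square ::
  "('g \<Rightarrow> 'h \<Rightarrow> 'i) \<Rightarrow> ('g, 'k::field) presentation \<Rightarrow> ('h, 'k) presentation \<Rightarrow>
   ('i, 'k) presentation" where
  "black_square tens P Q = \<lparr>
     gens = {tens g h | g h. g \<in> gens P \<and> h \<in> gens Q},
     rels = {lin_ext fscale (\<lambda>t. lin_ext fscale (psi_tree tens t) q) p | p q.
               p \<in> rels P \<and> q \<in> rels Q}\<rparr>"

definition As :: "(dir list, 'k::field) presentation" where
  "As = \<lparr>gens = {[]}, rels = {basis (comp1 [] []) - basis (comp2 [] [])}\<rparr>"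

definition Dend :: "(dir, 'k::field) presentation" where
  "Dend = \<lparr>gens = UNIV, rels = {
     basis (comp1 Prec Prec) - (basis (comp2 Prec Prec) + basis (comp2 Prec Succ)),
     basis (comp1 Prec Succ) - basis (comp2 Succ Prec),
     basis (comp1 Succ Prec) + basis (comp1 Succ Succ) - basis (comp2 Succ Succ)}\<rparr>"

text \<open>
  The basis vector \<open>\<mu>\<^sub>1 \<otimes> \<dots> \<otimes> \<mu>\<^sub>k\<close> is labelled \<open>[\<mu>\<^sub>1, \<dots>, \<mu>\<^sub>k]\<close>. Since \<open>As\<close> is a unit for the
  black square product, the first power is \<open>Dend\<close>.
\<close>

primrec Dend_pow :: "nat \<Rightarrow> (dir list, 'k::field) presentation" where
  "Dend_pow 0 = As"
| "Dend_pow (Suc k) = black_square (\<lambda>w \<mu>. w @ [\<mu>]) (Dend_pow k) Dend"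

text \<open>
  In both cases the generators correspond to the \<open>(i\<^sub>1, \<dots>, i\<^sub>k) \<in> {0,1}\<^sup>k\<close>, with \<open>Prec\<close> for \<open>0\<close>,
  \<open>Succ\<close> for \<open>1\<close>, and \<open>flip\<close> for \<open>i \<mapsto> 1 - i\<close>.
\<close>

lemma gens_BSu_Com: "gens ((BSu ^^ k) Com) = {w. length w = k}"
proof (induction k)
  case 0
  show ?case by (auto simp: Com_def)
next
  case (Suc k)
  have "{w @ [\<mu>] | w \<mu>. length w = k} = {w :: dir list. length w = Suc k}"
    by (auto simp: length_Suc_conv_rev)
  with Suc show ?case by (simp add: BSu_def)
qed

lemma gens_Dend_pow: "gens (Dend_pow k) = {w. length w = k}"
proof (induction k)
  case 0
  show ?case by (auto simp: As_def)
next
  case (Suc k)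
  have "{w @ [\<mu>] | w \<mu>. length w = k} = {w :: dir list. length w = Suc k}"
    by (auto simp: length_Suc_conv_rev)
  with Suc show ?case by (simp add: black_square_def Dend_def)
qed

section \<open>Matrices\<close>

definition mat_scale :: "('k \<Rightarrow> 'a \<Rightarrow> 'a) \<Rightarrow> 'k \<Rightarrow> 'a ^ 'n ^ 'm \<Rightarrow> 'a ^ 'n ^ 'm" where
  "mat_scale s c = map_matrix (s c)"

definition mat_op ::
  "('g \<Rightarrow> 'a \<Rightarrow> 'a \<Rightarrow> 'a) \<Rightarrow> 'g \<Rightarrow> 'a ^ 'n ^ 'n \<Rightarrow> 'a ^ 'n ^ 'n \<Rightarrow> 'a::comm_monoid_add ^ 'n ^ 'n"
  where "mat_op opr g M N = (\<chi> i j. \<Sum>l\<in>UNIV. opr g (M $ i $ l) (N $ l $ j))"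

end

theory Submission
  imports Defs
begin

text \<open>
  The relators of the black square powers of \<open>Dend\<close> are, as planar trees, relators of the iterated
  bisuccessors of \<open>Com\<close>: taking the black square product with \<open>Dend\<close> and applying \<open>BSu\<close> transform
  a quadratic relator in the same way. As the leaves of these trees are in the order \<open>1, 2, 3\<close>, an
  entry of a relator evaluated at three matrices is a sum of values of the same relator at entries
  of the matrices, hence vanishes. The transposition formula is the exchange rule at a vertex,
  because \<open>(12)\<close> acts on the generators by flipping every component of the label.
\<close>

section \<open>Linear extension\<close>

lemma lookup_fscale [simp]: "Poly_Mapping.lookup (fscale c p) t = c * Poly_Mapping.lookup p t"
  unfolding fscale_def by (simp add: Poly_Mapping.map.rep_eq when_def)

lemma vector_space_fscale: "vector_space fscale"
  by standard (auto intro!: poly_mapping_eqI simp: lookup_add algebra_simps)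

lemma lin_ext_cong:
  "(\<And>t. t \<in> Poly_Mapping.keys p \<Longrightarrow> f t = g t) \<Longrightarrow> lin_ext s f p = lin_ext s g p"
  unfolding lin_ext_def by (auto intro: sum.cong)

lemma lin_ext_0 [simp]: "lin_ext s f 0 = 0"
  by (simp add: lin_ext_def)

lemma linear_lin_ext:
  assumes "Vector_Spaces.linear s s' F"
  shows "F (lin_ext s f p) = lin_ext s' (\<lambda>t. F (f t)) p"
proof -
  interpret Vector_Spaces.linear s s' F by fact
  show ?thesis by (simp add: lin_ext_def sum scale)
qed

context vector_space
begin

text \<open>Coefficients vanish off the support, so combinations with different supports can be
  summed over one common finite set.\<close>

lemma lin_ext_superset:
  assumes "finite S" "Poly_Mapping.keys p \<subseteq> S"
  shows "lin_ext scale f p = (\<Sum>t\<in>S. scale (Poly_Mapping.lookup p t) (f t))"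
  unfolding lin_ext_def using assms by (intro sum.mono_neutral_left) (auto simp: in_keys_iff)

lemma lin_ext_add: "lin_ext scale f (p + q) = lin_ext scale f p + lin_ext scale f q"
proof -
  \<comment> \<open>Cancellation may make the support of \<open>p + q\<close> smaller than this
    union, hence the common index set.\<close>
  let ?S = "Poly_Mapping.keys p \<union> Poly_Mapping.keys q"
  have "lin_ext scale f r = (\<Sum>t\<in>?S. scale (Poly_Mapping.lookup r t) (f t))"
    if "r \<in> {p, q, p + q}" for r
    using that Poly_Mapping.keys_add[of p q] by (intro lin_ext_superset) auto
  then show ?thesis by (simp add: lookup_add scale_left_distrib sum.distrib)
qed

lemma lin_ext_fscale: "lin_ext scale f (fscale c p) = scale c (lin_ext scale f p)"
proof -
  have "lin_ext scale f (fscale c p) =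
      (\<Sum>t\<in>Poly_Mapping.keys p. scale (Poly_Mapping.lookup (fscale c p) t) (f t))"
    by (intro lin_ext_superset) (auto simp: in_keys_iff)
  then show ?thesis by (simp add: lin_ext_def scale_sum_right)
qed

lemma linear_lin_ext_right: "Vector_Spaces.linear fscale scale (lin_ext scale f)"
  unfolding Vector_Spaces.linear_iff
  using vector_space_fscale vector_space_axioms lin_ext_add lin_ext_fscale by blast

lemma lin_ext_diff: "lin_ext scale f (p - q) = lin_ext scale f p - lin_ext scale f q"
proof -
  interpret Vector_Spaces.linear fscale scale "lin_ext scale f" by (rule linear_lin_ext_right)
  show ?thesis by (rule diff)
qed

lemma lin_ext_basis [simp]: "lin_ext scale f (basis t) = f t"
  by (simp add: lin_ext_def)

lemma lin_ext_lin_ext: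
  "lin_ext scale f (lin_ext fscale g p) = lin_ext scale (\<lambda>t. lin_ext scale f (g t)) p"
  by (rule linear_lin_ext[OF linear_lin_ext_right])

end

lemmas fscale_lin_ext_simps [simp] =
  vector_space.lin_ext_add[OF vector_space_fscale]
  vector_space.lin_ext_diff[OF vector_space_fscale]
  vector_space.lin_ext_basis[OF vector_space_fscale]

lemma keys_lin_ext:
  fixes f :: "'t \<Rightarrow> ('u \<Rightarrow>\<^sub>0 'k::field)"
  shows "Poly_Mapping.keys (lin_ext fscale f p) \<subseteq>
     (\<Union>t\<in>Poly_Mapping.keys p. Poly_Mapping.keys (f t))"
proof -
  have keys_sum: "Poly_Mapping.keys (sum g S) \<subseteq> (\<Union>t\<in>S. Poly_Mapping.keys (g t))" if "finite S"
    for g :: "'t \<Rightarrow> 'u \<Rightarrow>\<^sub>0 'k" and S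
    using that by (induction S) (use Poly_Mapping.keys_add in fastforce)+
  show ?thesis
    unfolding lin_ext_def
    by (rule order_trans[OF keys_sum[OF finite_keys]], intro UN_mono order_refl)
      (auto simp: in_keys_iff)
qed

section \<open>Algebras over presented ns operads\<close>

lemma leaves_tree_subst: "leaves (tree_subst f t) = concat (map (\<lambda>j. leaves (f j)) (leaves t))"
  by (induction t) auto

lemma leaves_relabel_leaves: "leaves (relabel_leaves \<sigma> t) = map \<sigma> (leaves t)"
  unfolding relabel_leaves_def by (induction t) auto

lemma labels_tree_subst:
  "labels (tree_subst f t) \<subseteq> labels t \<union> (\<Union>j\<in>set (leaves t). labels (f j))"
  by (induction t) auto

lemma labels_relabel_leaves [simp]: "labels (relabel_leaves \<sigma> t) = labels t"
  unfolding relabel_leaves_def by (induction t) auto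

text \<open>The leaves of \<open>t\<close> fall into those before \<open>i\<close>, \<open>i\<close>
  itself and those after. Grafting fixes the first block, replaces the second by the shifted leaves
  of \<open>u\<close> and moves the third by \<open>n - 1\<close>; the three resulting intervals
  abut.\<close>

lemma tree_comp_ns_trees:
  assumes t: "t \<in> ns_trees X m" and u: "u \<in> ns_trees X n" and i: "i \<in> {1..m}"
  shows "tree_comp t i u \<in> ns_trees X (m + n - 1)"
proof -
  let ?f = "\<lambda>j. if j < i then Leaf j else if j = i then relabel_leaves (\<lambda>a. a + i - 1) u
     else Leaf (j + length (leaves u) - 1)"
  have lu: "leaves u = [1..<Suc n]" and lt: "leaves t = [1..<Suc m]"
    using t u by (auto simp: ns_trees_def)
  \<comment> \<open>The bound \<open>1 \<le> a\<close> matters: at \<open>j = c = 0\<close> the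
    truncated subtraction would not be a shift.\<close>
  have shift: "map (\<lambda>j. j + c - 1) [a..<b] = [a + c - 1..<b + c - 1]" if "1 \<le> a" for a b c :: nat
    using that
  proof (induction b)
    case (Suc b)
    then show ?case by (cases b) (auto simp: le_Suc_eq)
  qed auto
  have append: "[a..<b] @ [b..<c] = [a..<c]" if "a \<le> b" "b \<le> c" for a b c :: nat
    using that upt_add_eq_append[of a b "c - b"] by simp
  have split: "[1..<Suc m] = [1..<i] @ [i] @ [Suc i..<Suc m]"
    using append[of 1 i "Suc m"] i by (simp add: upt_conv_Cons del: upt_Suc)
  have 1: "concat (map (\<lambda>j. leaves (?f j)) [1..<i]) = [1..<i]"
  proof -
    have "map (\<lambda>j. leaves (?f j)) [1..<i] = map (\<lambda>j. [j]) [1..<i]" by simp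
    then show ?thesis by (simp only: concat_map_singleton map_ident)
  qed
  have 2: "leaves (?f i) = [i..<n + i]"
    using shift[of 1 i "Suc n"] i by (simp add: leaves_relabel_leaves lu)
  have 3: "concat (map (\<lambda>j. leaves (?f j)) [Suc i..<Suc m]) = [n + i..<m + n]"
  proof -
    have "map (\<lambda>j. leaves (?f j)) [Suc i..<Suc m] = map (\<lambda>j. [j + n - 1]) [Suc i..<Suc m]"
      by (simp add: lu del: upt_Suc)
    then have "concat (map (\<lambda>j. leaves (?f j)) [Suc i..<Suc m]) =
        map (\<lambda>j. j + n - 1) [Suc i..<Suc m]"
      by (simp only: concat_map_singleton)
    then show ?thesis using shift[of "Suc i" n "Suc m"] by (simp add: add.commute)
  qed
  have "leaves (tree_comp t i u) = [1..<i] @ [i..<n + i] @ [n + i..<m + n]"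
    unfolding tree_comp_def leaves_tree_subst lt split map_append concat_append 1 3
    using 2 by simp
  also have "\<dots> = [1..<Suc (m + n - 1)]"
    using i by (simp add: append del: upt_Suc)
  finally have "leaves (tree_comp t i u) = [1..<Suc (m + n - 1)]" .
  moreover have "labels (tree_comp t i u) \<subseteq> X"
    using labels_tree_subst[of ?f t] t u
    by (fastforce simp: ns_trees_def tree_comp_def split: if_splits)
  ultimately show ?thesis by (simp add: ns_trees_def)
qed

lemma partial_comp_basis_right:
  "partial_comp p i (basis u) = lin_ext fscale (\<lambda>t. basis (tree_comp t i u)) p"
  by (simp add: partial_comp_def)

lemma partial_comp_basis_left:
  "partial_comp (basis t) i q = lin_ext fscale (\<lambda>u. basis (tree_comp t i u)) q"
  by (simp add: partial_comp_def)

text \<open>\<open>tree_comp\<close> renumbers by the number of leaves of the grafted tree; the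
  support bound makes this number constant, equal to the arity, over an ideal element.\<close>

lemma keys_ns_ideal:
  "ns_ideal P m p \<Longrightarrow> Poly_Mapping.keys p \<subseteq> ns_trees (gens P) m"
proof (induction rule: ns_ideal.induct)
  case (add m p q)
  then show ?case using Poly_Mapping.keys_add[of p q] by blast
next
  case (scale m p c)
  then show ?case by (auto simp: in_keys_iff)
next
  case (comp_left m p i u n)
  show ?case
    unfolding partial_comp_basis_right
    by (rule order_trans[OF keys_lin_ext]) (use comp_left in \<open>auto simp del: One_nat_def intro!: tree_comp_ns_trees\<close>)
next
  case (comp_right n p t m i)
  show ?case
    unfolding partial_comp_basis_left
    by (rule order_trans[OF keys_lin_ext]) (use comp_right in \<open>auto simp del: One_nat_def intro!: tree_comp_ns_trees\<close>)
qed auto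

lemma eval_tree_subst:
  "eval_tree opr v (tree_subst f t) = eval_tree opr (\<lambda>j. eval_tree opr v (f j)) t"
  by (induction t) auto

text \<open>The value of \<open>u\<close> enters as a function update at \<open>i\<close>, the form
  in which \<open>linear_eval_tree\<close> expresses linearity in one leaf.\<close>

lemma eval_tree_comp:
  "eval_tree opr v (tree_comp t i u) =
   eval_tree opr ((\<lambda>j. if j < i then v j else v (j + length (leaves u) - 1))
     (i := eval_tree opr (\<lambda>a. v (a + i - 1)) u)) t"
  unfolding tree_comp_def eval_tree_subst relabel_leaves_def
  by (rule arg_cong[where f = "\<lambda>v. eval_tree opr v t"]) (auto simp: eval_tree_subst)

lemma eval_tree_upd_notin:
  "i \<notin> set (leaves t) \<Longrightarrow> eval_tree opr (v(i := y)) t = eval_tree opr v t"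
  by (induction t) auto

text \<open>A label occurring once lies in exactly one of the two subtrees of a vertex; the other
  subtree has a constant value, so each vertex on the path to the leaf contributes one linear
  map.\<close>

lemma linear_eval_tree:
  assumes "bilinear_ops s opr X" "labels t \<subseteq> X" "distinct (leaves t)" "i \<in> set (leaves t)"
  shows "Vector_Spaces.linear s s (\<lambda>y. eval_tree opr (v(i := y)) t)"
  using assms(2-)
proof (induction t)
  case (Leaf j)
  then show ?case
    using assms(1) by (simp add: bilinear_ops_def Vector_Spaces.linear_iff)
next
  case (Node g l r)
  have lin: "Vector_Spaces.linear s s (\<lambda>b. opr g a b)" "Vector_Spaces.linear s s (\<lambda>b. opr g b a)"
    for a using assms(1) Node.prems by (auto simp: bilinear_ops_def)
  show ?case
  proof (cases "i \<in> set (leaves l)")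
    case True
    moreover from this have "i \<notin> set (leaves r)" using Node.prems by auto
    ultimately show ?thesis
      using Node.prems Vector_Spaces.linear_compose[OF Node.IH(1) lin(2)]
      by (auto simp: eval_tree_upd_notin o_def simp del: fun_upd_apply)
  next
    case False
    with Node.prems show ?thesis
      using Vector_Spaces.linear_compose[OF Node.IH(2) lin(1)]
      by (auto simp: eval_tree_upd_notin o_def simp del: fun_upd_apply)
  qed
qed

text \<open>Vanishing spreads from the relators to the ideal by induction. Grafting a tree into an
  ideal element only changes the valuation, which is why \<open>v\<close> is arbitrary in the
  induction; grafting an ideal element into a tree applies a linear map to its value 0.\<close>

lemma ns_algebraI:
  assumes bil: "bilinear_ops s opr (gens P)"
    and rels: "\<And>p v. p \<in> rels P \<Longrightarrow> lin_ext s (eval_tree opr v) p = 0"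
  shows "ns_algebra P s opr"
proof -
  interpret vector_space s using bil by (simp add: bilinear_ops_def)
  have "lin_ext s (eval_tree opr v) p = 0" if "ns_ideal P m p" for m p v
    using that
  proof (induction arbitrary: v rule: ns_ideal.induct)
    case (comp_left m p i u n)
    then show ?case
      by (simp add: partial_comp_basis_right lin_ext_lin_ext eval_tree_comp)
  next
    case (comp_right n p t m i)
    \<comment> \<open>The arity \<open>n\<close> replaces \<open>length (leaves u)\<close>, so that
      the valuation off \<open>i\<close> is the same for every tree \<open>u\<close> of the
      support.\<close>
    let ?w = "\<lambda>j. if j < i then v j else v (j + n - 1)"
    have len: "length (leaves u) = n" if "u \<in> Poly_Mapping.keys p" for u
      using that keys_ns_ideal[OF comp_right.hyps(1)] by (auto simp: ns_trees_def)
    have lin: "Vector_Spaces.linear s s (\<lambda>y. eval_tree opr (?w(i := y)) t)"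
      using comp_right.hyps by (intro linear_eval_tree[OF bil]) (auto simp: ns_trees_def)
    have "lin_ext s (eval_tree opr v) (partial_comp (basis t) i p) =
        lin_ext s (\<lambda>u. eval_tree opr (?w(i := eval_tree opr (\<lambda>a. v (a + i - 1)) u)) t) p"
      by (simp add: partial_comp_basis_left lin_ext_lin_ext eval_tree_comp)
        (intro lin_ext_cong, simp only: len One_nat_def)
    also have "\<dots> = eval_tree opr (?w(i := 0)) t"
      using linear_lin_ext[OF lin, of "eval_tree opr (\<lambda>a. v (a + i - 1))" p]
        comp_right.IH[of "\<lambda>a. v (a + i - 1)"] by simp
    \<comment> \<open>On the empty combination, \<open>linear_lin_ext\<close> says that a linear map
      sends 0 to 0.\<close>
    also have "\<dots> = 0"
      using linear_lin_ext[OF lin, of "\<lambda>_. 0" 0] by simp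
    finally show ?case .
  qed (auto simp: rels lin_ext_add lin_ext_fscale)
  with bil show ?thesis by (auto simp: ns_algebra_def)
qed

section \<open>The relators of the black square powers of \<open>Dend\<close>\<close>

text \<open>A basis of \<open>(V \<circ>\<^sub>1 V) \<oplus> (V \<circ>\<^sub>2 V)\<close> for V
  with basis \<open>X\<close>.\<close>

definition quadratic_trees :: "'g set \<Rightarrow> 'g tree set" where
  "quadratic_trees X = (\<Union>g\<in>X. \<Union>h\<in>X. {comp1 g h, comp2 g h})"

lemma quadratic_trees_sym_trees: "quadratic_trees X \<subseteq> sym_trees X 3"
proof -
  have "{1..3} = {1, 2, 3::nat}" by (simp add: numeral_eq_Suc atLeastAtMostSuc_conv insert_commute)
  then show ?thesis
    by (simp add: quadratic_trees_def sym_trees_def comp1_def comp2_def UN_subset_iff)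
qed

lemma node_lin_basis [simp]: "node_lin g (basis l) (basis r) = basis (Node g l r)"
  by (simp add: node_lin_def)

lemma node_lin_add_left: "node_lin g (p + p') q = node_lin g p q + node_lin g p' q"
  by (simp add: node_lin_def)

text \<open>In a quadratic tree one child of the root is a leaf, so whenever the right child expands
  to a sum, the left one is a basis vector.\<close>

lemma node_lin_add_right:
  "node_lin g (basis l) (q + q') = node_lin g (basis l) q + node_lin g (basis l) q'"
  by (simp add: node_lin_def)

text \<open>
  The three relators of \<open>Dend\<close> correspond to the three leaves. The sign in \<open>\<Psi>\<close> cancels the one that
  the relators of \<open>Dend\<close> carry on trees \<open>\<mu> \<circ>\<^sub>2 \<nu>\<close>.
\<close>

lemma psi_tree_Dend:
  assumes "q \<in> rels (Dend :: (dir, 'k::field) presentation)"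
  obtains x where "x \<in> {1, 2, 3}"
    and "\<And>t. t \<in> quadratic_trees X \<Longrightarrow>
      lin_ext fscale (psi_tree (\<lambda>w \<mu>. w @ [\<mu>]) t) q = (bsu_tree x t :: dir list tree \<Rightarrow>\<^sub>0 'k)"
proof -
  note simps = quadratic_trees_def comp1_def comp2_def node_lin_add_left node_lin_add_right
  \<comment> \<open>The paths to leaves 1, 2, 3 turn left-left, left-right, right in
    \<open>comp1\<close> and left, right-left, right-right in \<open>comp2\<close>. After a single
    turn the inner vertex is off the path and receives both directions, which gives the two-term
    sides of the first and third relators.\<close>
  consider
    "q = basis (comp1 Prec Prec) - (basis (comp2 Prec Prec) + basis (comp2 Prec Succ))" |
    "q = basis (comp1 Prec Succ) - basis (comp2 Succ Prec)" |
    "q = basis (comp1 Succ Prec) + basis (comp1 Succ Succ) - basis (comp2 Succ Succ)"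
    using assms by (auto simp: Dend_def)
  then show thesis
  proof cases
    case 1
    then show thesis by (intro that[of 1]) (auto simp: simps)
  next
    case 2
    then show thesis by (intro that[of 2]) (auto simp: simps)
  next
    case 3
    then show thesis by (intro that[of 3]) (auto simp: simps)
  qed
qed

lemma keys_bsu_tree_quadratic:
  assumes "t \<in> quadratic_trees {w. length w = k}" "x \<in> {1, 2, 3}"
  shows "Poly_Mapping.keys (bsu_tree x t :: dir list tree \<Rightarrow>\<^sub>0 'k::field)
    \<subseteq> quadratic_trees {w. length w = Suc k}"
  using assms
  by (auto simp: quadratic_trees_def comp1_def comp2_def node_lin_add_left node_lin_add_right
      dest!: subsetD[OF Poly_Mapping.keys_add])

lemma leaves_quadratic_tree: "t \<in> quadratic_trees X \<Longrightarrow> set (leaves t) = {1, 2, 3}"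
  by (auto simp: quadratic_trees_def comp1_def comp2_def)

text \<open>Both claims go through one induction on \<open>k\<close>: the support bound is what
  allows \<open>psi_tree_Dend\<close> to be applied to every tree of a relator. The value 0 is set
  apart because \<open>BSu\<close> draws \<open>x\<close> from the support of a relator, so a zero
  relator yields nothing.\<close>

lemma rels_Dend_pow:
  assumes "p \<in> rels (Dend_pow k :: (dir list, 'k::field) presentation)"
  shows "Poly_Mapping.keys p \<subseteq> quadratic_trees {w. length w = k}"
    and "p \<in> insert 0 (rels ((BSu ^^ k) Com))"
proof -
  have "Poly_Mapping.keys p \<subseteq> quadratic_trees {w. length w = k} \<and>
      p \<in> insert 0 (rels ((BSu ^^ k) Com))"
    using assms
  proof (induction k arbitrary: p)
    case 0
    then have p: "p = basis (comp1 [] []) - basis (comp2 [] [])" by (simp add: As_def)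
    then have "Poly_Mapping.keys p \<subseteq> {comp1 [] [], comp2 [] []}"
      using keys_diff[of "basis (comp1 [] [])" "basis (comp2 [] []) :: _ \<Rightarrow>\<^sub>0 'k"] by auto
    with p show ?case by (auto simp: Com_def quadratic_trees_def)
  next
    case (Suc k)
    then obtain p' q where p': "p' \<in> rels (Dend_pow k :: (dir list, 'k) presentation)"
      and q: "q \<in> rels (Dend :: (dir, 'k) presentation)"
      and p: "p = lin_ext fscale (\<lambda>t. lin_ext fscale (psi_tree (\<lambda>w \<mu>. w @ [\<mu>]) t) q) p'"
      by (auto simp: black_square_def)
    note IH = Suc.IH[OF p']
    \<comment> \<open>The leaf \<open>x\<close> depends on \<open>q\<close> alone, so all trees of
      \<open>p'\<close> share it and \<open>p\<close> is the bisuccessor of \<open>p'\<close> at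
      \<open>x\<close>.\<close>
    obtain x where x: "x \<in> {1, 2, 3}"
      and "\<And>t. t \<in> quadratic_trees {w. length w = k} \<Longrightarrow>
        lin_ext fscale (psi_tree (\<lambda>w \<mu>. w @ [\<mu>]) t) q = (bsu_tree x t :: dir list tree \<Rightarrow>\<^sub>0 'k)"
      by (rule psi_tree_Dend[OF q, of "{w. length w = k}"]) blast
    then have p: "p = lin_ext fscale (bsu_tree x) p'"
      unfolding p using IH by (intro lin_ext_cong) auto
    have keys: "Poly_Mapping.keys p \<subseteq> quadratic_trees {w. length w = Suc k}"
      unfolding p
      by (rule order_trans[OF keys_lin_ext]) (use IH keys_bsu_tree_quadratic[OF _ x] in blast)
    have "p \<in> insert 0 (rels ((BSu ^^ Suc k) Com))"
    proof (cases "p' = 0")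
      case True
      then show ?thesis by (simp add: p)
    next
      case False
      then obtain t where "t \<in> Poly_Mapping.keys p'" by fastforce
      moreover from this have "x \<in> set (leaves t)"
        using IH x leaves_quadratic_tree by blast
      moreover have "p' \<in> rels ((BSu ^^ k) Com)" using IH False by simp
      ultimately show ?thesis unfolding p by (auto simp: BSu_def)
    qed
    with keys show ?case by simp
  qed
  then show "Poly_Mapping.keys p \<subseteq> quadratic_trees {w. length w = k}"
    and "p \<in> insert 0 (rels ((BSu ^^ k) Com))" by auto
qed

section \<open>Algebras over the bisuccessors of \<open>Com\<close>\<close>

text \<open>On \<open>Com\<close> the action is trivial, and each \<open>BSu\<close> flips the
  direction that it appends.\<close>

lemma act_BSu_Com:
  "length w = k \<Longrightarrow> act ((BSu ^^ k) Com) w = (basis (map flip w) :: dir list \<Rightarrow>\<^sub>0 'k::field)"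
proof (induction k arbitrary: w)
  case 0
  then show ?case by (simp add: Com_def)
next
  case (Suc k)
  then obtain u \<mu> where "w = u @ [\<mu>]" "length u = k" by (auto simp: length_Suc_conv_rev)
  with Suc.IH show ?case by (simp add: BSu_def)
qed

text \<open>This is the exchange relation at the one-vertex tree with leaves 1 and 2, evaluated at
  \<open>a\<close> and \<open>b\<close>.\<close>

lemma BSu_Com_algebra_flip:
  assumes A: "sym_algebra ((BSu ^^ k) (Com :: (dir list, 'k::field) sym_presentation)) s star"
    and w: "length w = k"
  shows "star (map flip w) b a = star w a b"
proof -
  let ?P = "(BSu ^^ k) (Com :: (dir list, 'k) sym_presentation)"
  interpret vector_space s using A by (simp add: sym_algebra_def bilinear_ops_def)
  have "{1..2} = {1, 2::nat}" by auto
  then have "Node w (Leaf 1) (Leaf 2) \<in> sym_trees (gens ?P) 2"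
    using w by (simp add: sym_trees_def gens_BSu_Com)
  from sym_ideal.exchange[OF this]
  have "lin_ext s (eval_tree star (\<lambda>i. if i = 1 then a else b))
      (basis (Node w (Leaf 1) (Leaf 2)) - basis (Node (map flip w) (Leaf 2) (Leaf 1))) = 0"
    using A w by (simp add: sym_algebra_def act_BSu_Com)
  then show ?thesis by (simp add: lin_ext_diff)
qed

lemma BSu_Com_algebra_rels_Dend_pow:
  assumes A: "sym_algebra ((BSu ^^ k) (Com :: (dir list, 'k::field) sym_presentation)) s star"
    and p: "p \<in> rels (Dend_pow k)"
  shows "lin_ext s (eval_tree star v) p = 0"
proof (cases "p = 0")
  case False
  with rels_Dend_pow(2)[OF p] have "p \<in> rels ((BSu ^^ k) Com)" by simp
  moreover have "Poly_Mapping.keys p \<subseteq> sym_trees (gens ((BSu ^^ k) Com :: (dir list, 'k) sym_presentation)) 3"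
    using rels_Dend_pow(1)[OF p] quadratic_trees_sym_trees by (auto simp: gens_BSu_Com)
  ultimately have "sym_ideal ((BSu ^^ k) Com) 3 p" by (rule sym_ideal.rel)
  with A show ?thesis by (auto simp: sym_algebra_def)
qed simp

section \<open>Matrices\<close>

lemma mat_scale_nth [simp]: "mat_scale s c M $ i $ j = s c (M $ i $ j)"
  by (simp add: mat_scale_def map_matrix_def)

lemma vector_space_mat_scale:
  assumes "vector_space s"
  shows "vector_space (mat_scale s)"
proof -
  interpret vector_space s by fact
  show ?thesis
    by standard (auto simp: vec_eq_iff scale_left_distrib scale_right_distrib)
qed

lemma lin_ext_mat_scale_nth:
  "lin_ext (mat_scale s) f p $ i $ j = lin_ext s (\<lambda>t. f t $ i $ j) p"
  by (simp add: lin_ext_def)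

lemma bilinear_ops_mat_op:
  assumes "bilinear_ops s opr X"
  shows "bilinear_ops (mat_scale s) (mat_op opr) X"
proof -
  interpret vector_space s using assms by (simp add: bilinear_ops_def)
  show ?thesis
    using assms vector_space_mat_scale[of s]
    by (auto simp: bilinear_ops_def Vector_Spaces.linear_iff mat_op_def vec_eq_iff
        sum.distrib scale_sum_right)
qed

text \<open>With leaves in the order 1, 2, 3, both bracketings of a triple matrix product chain the
  indices i, l, m, j in the same way. The valuation on the right is thus independent of the tree,
  which lets a whole relator be evaluated at once; its last branch serves leaf 3.\<close>

lemma eval_tree_mat_op_quadratic:
  assumes "bilinear_ops s opr X" "t \<in> quadratic_trees X"
  shows "eval_tree (mat_op opr) v t $ i $ j =
    (\<Sum>l\<in>UNIV. \<Sum>m\<in>UNIV.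
      eval_tree opr (\<lambda>a. if a = 1 then v 1 $ i $ l else if a = 2 then v 2 $ l $ m else v 3 $ m $ j) t)"
proof -
  obtain g h where t: "t \<in> {comp1 g h, comp2 g h}" "g \<in> X"
    using assms(2) by (auto simp: quadratic_trees_def)
  have 1: "opr g (sum f S) b = (\<Sum>l\<in>S. opr g (f l) b)" for f b and S :: "'e set"
  proof -
    interpret Vector_Spaces.linear s s "\<lambda>a. opr g a b"
      using assms(1) t by (simp add: bilinear_ops_def)
    show ?thesis by (rule sum)
  qed
  have 2: "opr g b (sum f S) = (\<Sum>l\<in>S. opr g b (f l))" for f b and S :: "'e set"
  proof -
    interpret Vector_Spaces.linear s s "opr g b"
      using assms(1) t by (simp add: bilinear_ops_def)
    show ?thesis by (rule sum)
  qed
  \<comment> \<open>For \<open>comp1\<close> the sum over m comes out first, hence the swap.\<close>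
  from t(1) show ?thesis
    by (auto simp: comp1_def comp2_def mat_op_def 1 2 intro: sum.swap)
qed

lemma ns_algebra_mat_op:
  assumes A: "sym_algebra ((BSu ^^ k) (Com :: (dir list, 'k::field) sym_presentation)) s star"
  shows "ns_algebra (Dend_pow k)
    (mat_scale s :: 'k \<Rightarrow> 'a::ab_group_add ^ 'n::finite ^ 'n \<Rightarrow> 'a ^ 'n ^ 'n) (mat_op star)"
proof (rule ns_algebraI)
  have bil: "bilinear_ops s star {w. length w = k}"
    using A by (simp add: sym_algebra_def gens_BSu_Com)
  then interpret vector_space s by (simp add: bilinear_ops_def)
  show "bilinear_ops (mat_scale s :: 'k \<Rightarrow> 'a ^ 'n ^ 'n \<Rightarrow> 'a ^ 'n ^ 'n) (mat_op star)
      (gens (Dend_pow k :: (dir list, 'k) presentation))"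
    using bil by (simp add: gens_Dend_pow bilinear_ops_mat_op)
  fix p :: "dir list tree \<Rightarrow>\<^sub>0 'k" and v :: "nat \<Rightarrow> 'a ^ 'n ^ 'n"
  assume p: "p \<in> rels (Dend_pow k)"
  have "lin_ext s (\<lambda>t. eval_tree (mat_op star) v t $ i $ j) p = 0" for i j
  proof -
    let ?v = "\<lambda>l m a. if a = 1 then v 1 $ i $ l else if a = 2 then v 2 $ l $ m else v 3 $ m $ j"
    have "lin_ext s (\<lambda>t. eval_tree (mat_op star) v t $ i $ j) p =
        lin_ext s (\<lambda>t. \<Sum>l\<in>UNIV. \<Sum>m\<in>UNIV. eval_tree star (?v l m) t) p"
      using rels_Dend_pow(1)[OF p] eval_tree_mat_op_quadratic[OF bil]
      by (intro lin_ext_cong) blast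
    \<comment> \<open>The sum over the support of \<open>p\<close> moves inside the sums over both
      matrix indices.\<close>
    also have "\<dots> = (\<Sum>l\<in>UNIV. \<Sum>m\<in>UNIV. lin_ext s (eval_tree star (?v l m)) p)"
      unfolding lin_ext_def scale_sum_right
      by (subst sum.swap) (intro sum.cong refl sum.swap)
    finally show ?thesis by (simp add: BSu_Com_algebra_rels_Dend_pow[OF A p])
  qed
  then show "lin_ext (mat_scale s) (eval_tree (mat_op star) v) p = 0"
    by (simp add: vec_eq_iff lin_ext_mat_scale_nth)
qed

text \<open>A linear map commutes with the finite sum over the inner index of a matrix
  product.\<close>

lemma algebra_hom_map_matrix:
  assumes "algebra_hom X s opr s' opr' f"
  shows "algebra_hom X (mat_scale s) (mat_op opr) (mat_scale s') (mat_op opr')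
    (map_matrix f :: 'a::ab_group_add ^ 'n::finite ^ 'n \<Rightarrow> 'b::ab_group_add ^ 'n ^ 'n)"
proof -
  interpret Vector_Spaces.linear s s' f using assms by (simp add: algebra_hom_def)
  have "Vector_Spaces.linear (mat_scale s) (mat_scale s')
      (map_matrix f :: 'a ^ 'n ^ 'n \<Rightarrow> 'b ^ 'n ^ 'n)"
    unfolding Vector_Spaces.linear_iff
    using vector_space_mat_scale[OF vs1.vector_space_axioms]
      vector_space_mat_scale[OF vs2.vector_space_axioms]
    by (auto simp: vec_eq_iff map_matrix_def add scale)
  with assms show ?thesis
    by (auto simp: algebra_hom_def vec_eq_iff map_matrix_def mat_op_def sum)
qed

text \<open>The size of the matrices is the cardinality of the finite, nonempty index type
  \<open>'n\<close>. Functoriality is rendered by the action of \<open>map_matrix\<close> on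
  morphisms and its laws for identities and composites.\<close>

theorem corollary4p3:
  fixes k :: nat
    and s :: "'k::field \<Rightarrow> 'a::ab_group_add \<Rightarrow> 'a"
    and star :: "dir list \<Rightarrow> 'a \<Rightarrow> 'a \<Rightarrow> 'a"
  assumes A: "sym_algebra ((BSu ^^ k) Com) s star"
  shows
    "ns_algebra (Dend_pow k)
       (mat_scale s :: 'k \<Rightarrow> 'a ^ 'n::finite ^ 'n \<Rightarrow> 'a ^ 'n ^ 'n) (mat_op star) \<and>
     (\<forall>(s' :: 'k \<Rightarrow> 'b::ab_group_add \<Rightarrow> 'b) star' f.
        sym_algebra ((BSu ^^ k) Com) s' star' \<longrightarrow>
        algebra_hom (gens ((BSu ^^ k) (Com :: (dir list, 'k) sym_presentation))) s star s' star' f \<longrightarrow>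
        algebra_hom (gens (Dend_pow k :: (dir list, 'k) presentation))
          (mat_scale s) (mat_op star) (mat_scale s') (mat_op star')
          (map_matrix f :: 'a ^ 'n ^ 'n \<Rightarrow> 'b ^ 'n ^ 'n)) \<and>
     (map_matrix id :: 'a ^ 'n ^ 'n \<Rightarrow> 'a ^ 'n ^ 'n) = id \<and>
     (\<forall>(f :: 'a \<Rightarrow> 'b) (g :: 'b \<Rightarrow> 'c).
        (map_matrix (g \<circ> f) :: 'a ^ 'n ^ 'n \<Rightarrow> 'c ^ 'n ^ 'n) = map_matrix g \<circ> map_matrix f) \<and>
     (\<forall>w. length w = k \<longrightarrow>
        (\<forall>M N :: 'a ^ 'n ^ 'n.
           Finite_Cartesian_Product.transpose (mat_op star w M N) =
           mat_op star (map flip w) (Finite_Cartesian_Product.transpose N) (Finite_Cartesian_Product.transpose M)))"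
proof (intro conjI allI impI)
  show "ns_algebra (Dend_pow k)
      (mat_scale s :: 'k \<Rightarrow> 'a ^ 'n ^ 'n \<Rightarrow> 'a ^ 'n ^ 'n) (mat_op star)"
    by (rule ns_algebra_mat_op[OF A])
next
  fix s' :: "'k \<Rightarrow> 'b \<Rightarrow> 'b" and star' f
  assume "algebra_hom (gens ((BSu ^^ k) (Com :: (dir list, 'k) sym_presentation))) s star s' star' f"
  then show "algebra_hom (gens (Dend_pow k :: (dir list, 'k) presentation))
      (mat_scale s) (mat_op star) (mat_scale s') (mat_op star')
      (map_matrix f :: 'a ^ 'n ^ 'n \<Rightarrow> 'b ^ 'n ^ 'n)"
    unfolding gens_BSu_Com gens_Dend_pow by (rule algebra_hom_map_matrix)
next
  fix w :: "dir list" and M N :: "'a ^ 'n ^ 'n"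
  assume "length w = k"
  \<comment> \<open>Entrywise, transposition exchanges the two factors of each summand, and flipping
    the label compensates for this.\<close>
  then show "Finite_Cartesian_Product.transpose (mat_op star w M N) =
      mat_op star (map flip w) (Finite_Cartesian_Product.transpose N) (Finite_Cartesian_Product.transpose M)"
    by (simp add: vec_eq_iff Finite_Cartesian_Product.transpose_def mat_op_def
        BSu_Com_algebra_flip[OF A])
\<comment> \<open>What remains are the identity and composition laws, which hold entrywise.\<close>
qed (auto simp: fun_eq_iff vec_eq_iff map_matrix_def)

end
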